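(* The Possible Functional Dependency problem (PFD) can be solved in polynomial time: given a schema context on a relation scheme $U$, a relation $r$ over it, and a functional dependency $X\to A$, one can decide in time polynomial in the size of the input whether there exists a reality $g$ with $r\models_g X\to A$.
   Context: A relation scheme is a finite set $U=\{A_1,\dots,A_n\}$ of attributes with domains $\mathrm{dom}(A)$. A schema context assigns to each $A$ a finite lattice $L_A$ (bottom $0_A$, top $1_A$), given explicitly in the input, and a surjective comparability function $f_A:\mathrm{dom}(A)^2\to L_A$ with $f_A(u,u)=1_A$, $f_A(u,v)=f_A(v,u)$, whose values are assumed computable in constant time and of constant size. $L_U=\prod_A L_A$ (componentwise order). A relation $r$ is a finite set of tuples; $f_U(t_1,t_2)=\langle f_{A_i}(t_1[A_i],t_2[A_i])\rangle_i$, $f_U(r)=\{f_U(t_1,t_2):t_1,t_2\in r\}$. A functional dependency is $X\to A$ with $X\subseteq U$, $A\in U\setminus X$. An attribute interpretation is an increasing $h_A:L_A\to\{0,1\}$ with $h_A(0_A)=0,h_A(1_A)=1$; a schema interpretation is $g(x)=\langle h_{A_1}(x[A_1]),\dots,h_{A_n}(x[A_n])\rangle$, identified with a subset of $U$. A reality is a schema interpretation that is a $\wedge$-homomorphism into $\{0,1\}^n$ (componentwise order). $r\models_g X\to A$ means: for all $x\in f_U(r)$, $X\subseteq g(x)$ implies $A\in g(x)$. *)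

theory Defs
  imports
    "HOL-Algebra.Lattice"
    "HOL-Library.FuncSet"
    "HOL-Computational_Algebra.Polynomial"
begin

section \<open>Schema contexts, relations, realities\<close>

record ('a, 'v, 'l) schema =
  attrs :: "'a set"
  vals :: "'a \<Rightarrow> 'v set"
  lat :: "'a \<Rightarrow> 'l gorder"
  cmp :: "'a \<Rightarrow> 'v \<Rightarrow> 'v \<Rightarrow> 'l"

definition schema_context :: "('a, 'v, 'l) schema \<Rightarrow> bool" where
  "schema_context S \<longleftrightarrow>
     finite (attrs S) \<and>
     (\<forall>A \<in> attrs S.
        bounded_lattice (lat S A) \<and> finite (carrier (lat S A)) \<and>
        (\<lambda>(u, v). cmp S A u v) ` (vals S A \<times> vals S A) = carrier (lat S A) \<and>
        (\<forall>u \<in> vals S A. cmp S A u u = \<top>\<^bsub>lat S A\<^esub>) \<and>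
        (\<forall>u \<in> vals S A. \<forall>v \<in> vals S A. cmp S A u v = cmp S A v u))"

definition prod_lat :: "('a, 'v, 'l) schema \<Rightarrow> ('a \<Rightarrow> 'l) gorder" where
  "prod_lat S =
     \<lparr>carrier = (\<Pi>\<^sub>E A \<in> attrs S. carrier (lat S A)),
      eq = (=),
      le = (\<lambda>x y. \<forall>A \<in> attrs S. x A \<sqsubseteq>\<^bsub>lat S A\<^esub> y A)\<rparr>"

definition relation_over :: "('a, 'v, 'l) schema \<Rightarrow> ('a \<Rightarrow> 'v) set \<Rightarrow> bool" where
  "relation_over S r \<longleftrightarrow> finite r \<and> r \<subseteq> (\<Pi>\<^sub>E A \<in> attrs S. vals S A)"

definition tuple_cmp :: "('a, 'v, 'l) schema \<Rightarrow> ('a \<Rightarrow> 'v) \<Rightarrow> ('a \<Rightarrow> 'v) \<Rightarrow> 'a \<Rightarrow> 'l" where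
  "tuple_cmp S t1 t2 = (\<lambda>A \<in> attrs S. cmp S A (t1 A) (t2 A))"

definition rel_cmp :: "('a, 'v, 'l) schema \<Rightarrow> ('a \<Rightarrow> 'v) set \<Rightarrow> ('a \<Rightarrow> 'l) set" where
  "rel_cmp S r = {tuple_cmp S t1 t2 | t1 t2. t1 \<in> r \<and> t2 \<in> r}"

definition func_dep :: "('a, 'v, 'l) schema \<Rightarrow> 'a set \<Rightarrow> 'a \<Rightarrow> bool" where
  "func_dep S X A \<longleftrightarrow> X \<subseteq> attrs S \<and> A \<in> attrs S - X"

text \<open>
  The two-element set \<open>{0, 1}\<close> is \<open>bool\<close> with \<open>False < True\<close>, so that
  \<open>{0, 1}\<^sup>n\<close> is the powerset of the set of attributes, ordered by inclusion, with meet \<open>\<inter>\<close>.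
\<close>

definition attribute_interpretation :: "'l gorder \<Rightarrow> ('l \<Rightarrow> bool) \<Rightarrow> bool" where
  "attribute_interpretation L h \<longleftrightarrow>
     (\<forall>x \<in> carrier L. \<forall>y \<in> carrier L. x \<sqsubseteq>\<^bsub>L\<^esub> y \<longrightarrow> h x \<le> h y) \<and>
     h \<bottom>\<^bsub>L\<^esub> = False \<and> h \<top>\<^bsub>L\<^esub> = True"

definition schema_interpretation ::
    "('a, 'v, 'l) schema \<Rightarrow> (('a \<Rightarrow> 'l) \<Rightarrow> 'a set) \<Rightarrow> bool" where
  "schema_interpretation S g \<longleftrightarrow>
     (\<exists>h. (\<forall>A \<in> attrs S. attribute_interpretation (lat S A) (h A)) \<and>
          (\<forall>x \<in> carrier (prod_lat S). g x = {A \<in> attrs S. h A (x A)}))"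

definition reality :: "('a, 'v, 'l) schema \<Rightarrow> (('a \<Rightarrow> 'l) \<Rightarrow> 'a set) \<Rightarrow> bool" where
  "reality S g \<longleftrightarrow>
     schema_interpretation S g \<and>
     (\<forall>x \<in> carrier (prod_lat S). \<forall>y \<in> carrier (prod_lat S).
        g (x \<sqinter>\<^bsub>prod_lat S\<^esub> y) = g x \<inter> g y)"

definition satisfies_fd ::
    "('a, 'v, 'l) schema \<Rightarrow> (('a \<Rightarrow> 'l) \<Rightarrow> 'a set) \<Rightarrow> ('a \<Rightarrow> 'v) set \<Rightarrow> 'a set \<Rightarrow> 'a \<Rightarrow> bool" where
  "satisfies_fd S g r X A \<longleftrightarrow> (\<forall>x \<in> rel_cmp S r. X \<subseteq> g x \<longrightarrow> A \<in> g x)"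


section \<open>Machine model\<close>

text \<open>
  Imperative programs over binary trees (the WHILE language of N. D. Jones, Computability and
  Complexity: From a Programming Perspective), whose polynomial time is that of Turing machines.
  Attributes, values and lattice elements are opaque atoms of constant size. Programs contain
  no atoms, and can only test atoms for equality and, as a unit-cost operation, evaluate the
  comparability functions. Constructing and taking apart pairs has unit cost (pointers);
  the equality test does not look inside pairs.
\<close>

datatype ('a, 'v, 'l) atom = Attr 'a | Val 'v | Elem 'l

datatype 'c tree = Leaf | At 'c | Node "'c tree" "'c tree"

datatype expr =
    V nat
  | Null
  | Cons expr expr
  | Hd expr
  | Tl expr
  | Eq expr expr
  | Cmp expr expr expr

datatype com =
    Skip
  | Assign nat expr
  | Seq com com
  | If expr com com
  | While expr com

type_synonym 'c state = "nat \<Rightarrow> 'c tree"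

text \<open>Booleans: \<^const>\<open>Leaf\<close> is false, every other tree is true.\<close>

definition true :: "'c tree" where
  "true = Node Leaf Leaf"

fun hd_tree :: "'c tree \<Rightarrow> 'c tree" where
  "hd_tree (Node x y) = x"
| "hd_tree _ = Leaf"

fun tl_tree :: "'c tree \<Rightarrow> 'c tree" where
  "tl_tree (Node x y) = y"
| "tl_tree _ = Leaf"

fun eq_tree :: "'c tree \<Rightarrow> 'c tree \<Rightarrow> 'c tree" where
  "eq_tree Leaf Leaf = true"
| "eq_tree (At c) (At d) = (if c = d then true else Leaf)"
| "eq_tree _ _ = Leaf"

fun cmp_tree :: "('a \<Rightarrow> 'v \<Rightarrow> 'v \<Rightarrow> 'l) \<Rightarrow> ('a, 'v, 'l) atom tree \<Rightarrow> ('a, 'v, 'l) atom tree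
    \<Rightarrow> ('a, 'v, 'l) atom tree \<Rightarrow> ('a, 'v, 'l) atom tree" where
  "cmp_tree f (At (Attr A)) (At (Val u)) (At (Val v)) = At (Elem (f A u v))"
| "cmp_tree f _ _ _ = Leaf"

fun eval :: "('a \<Rightarrow> 'v \<Rightarrow> 'v \<Rightarrow> 'l) \<Rightarrow> expr \<Rightarrow> ('a, 'v, 'l) atom state \<Rightarrow> ('a, 'v, 'l) atom tree" where
  "eval f (V n) s = s n"
| "eval f Null s = Leaf"
| "eval f (Cons e1 e2) s = Node (eval f e1 s) (eval f e2 s)"
| "eval f (Hd e) s = hd_tree (eval f e s)"
| "eval f (Tl e) s = tl_tree (eval f e s)"
| "eval f (Eq e1 e2) s = eq_tree (eval f e1 s) (eval f e2 s)"
| "eval f (Cmp e1 e2 e3) s = cmp_tree f (eval f e1 s) (eval f e2 s) (eval f e3 s)"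

fun ecost :: "expr \<Rightarrow> nat" where
  "ecost (V n) = 1"
| "ecost Null = 1"
| "ecost (Cons e1 e2) = 1 + ecost e1 + ecost e2"
| "ecost (Hd e) = 1 + ecost e"
| "ecost (Tl e) = 1 + ecost e"
| "ecost (Eq e1 e2) = 1 + ecost e1 + ecost e2"
| "ecost (Cmp e1 e2 e3) = 1 + ecost e1 + ecost e2 + ecost e3"

text \<open>\<open>exec f c s t s'\<close>: started in state \<open>s\<close>, \<open>c\<close> halts after time \<open>t\<close> in state \<open>s'\<close>.\<close>

inductive exec :: "('a \<Rightarrow> 'v \<Rightarrow> 'v \<Rightarrow> 'l) \<Rightarrow> com \<Rightarrow> ('a, 'v, 'l) atom state \<Rightarrow> nat
    \<Rightarrow> ('a, 'v, 'l) atom state \<Rightarrow> bool" for f where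
  Skip: "exec f Skip s 1 s"
| Assign: "exec f (Assign n e) s (1 + ecost e) (s(n := eval f e s))"
| Seq: "exec f c1 s1 t1 s2 \<Longrightarrow> exec f c2 s2 t2 s3 \<Longrightarrow> exec f (Seq c1 c2) s1 (1 + t1 + t2) s3"
| IfTrue: "eval f b s \<noteq> Leaf \<Longrightarrow> exec f c1 s t s' \<Longrightarrow> exec f (If b c1 c2) s (1 + ecost b + t) s'"
| IfFalse: "eval f b s = Leaf \<Longrightarrow> exec f c2 s t s' \<Longrightarrow> exec f (If b c1 c2) s (1 + ecost b + t) s'"
| WhileFalse: "eval f b s = Leaf \<Longrightarrow> exec f (While b c) s (1 + ecost b) s"
| WhileTrue: "eval f b s1 \<noteq> Leaf \<Longrightarrow> exec f c s1 t1 s2 \<Longrightarrow> exec f (While b c) s2 t2 s3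
    \<Longrightarrow> exec f (While b c) s1 (1 + ecost b + t1 + t2) s3"

lemma exec_deterministic:
  "exec f c s t s' \<Longrightarrow> exec f c s u s'' \<Longrightarrow> t = u \<and> s' = s''"
proof (induction arbitrary: u s'' rule: exec.induct)
  case Skip then show ?case by (auto elim: exec.cases)
next
  case Assign then show ?case by (auto elim: exec.cases)
next
  case (Seq c1 s1 t1 s2 c2 t2 s3)
  from Seq.prems show ?case by cases (use Seq.IH in blast)
next
  case (IfTrue b s c1 t s' c2)
  from IfTrue.prems show ?case by cases (use IfTrue in blast)+
next
  case (IfFalse b s c2 t s' c1)
  from IfFalse.prems show ?case by cases (use IfFalse in blast)+
next
  case (WhileFalse b s c)
  from WhileFalse.prems show ?case by cases (use WhileFalse in auto)
next
  case (WhileTrue b s1 c t1 s2 t2 s3)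
  from WhileTrue.prems show ?case by cases (use WhileTrue in blast)+
qed

definition init_state :: "'c tree \<Rightarrow> 'c state" where
  "init_state d = (\<lambda>_. Leaf)(0 := d)"

text \<open>The input is in variable 0; on halting, variable 0 holds the answer.\<close>

definition decides_within :: "('a \<Rightarrow> 'v \<Rightarrow> 'v \<Rightarrow> 'l) \<Rightarrow> com \<Rightarrow> ('a, 'v, 'l) atom tree \<Rightarrow> nat \<Rightarrow> bool \<Rightarrow> bool"
  where
  "decides_within f c d T answer \<longleftrightarrow>
     (\<exists>t s. exec f c (init_state d) t s \<and> t \<le> T \<and> (s 0 \<noteq> Leaf \<longleftrightarrow> answer))"


section \<open>Encoding of the input\<close>

fun nodes :: "'c tree \<Rightarrow> nat" where
  "nodes Leaf = 1"
| "nodes (At c) = 1"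
| "nodes (Node x y) = 1 + nodes x + nodes y"

fun list_tree :: "'c tree list \<Rightarrow> 'c tree" where
  "list_tree [] = Leaf"
| "list_tree (x # xs) = Node x (list_tree xs)"

definition enumerates :: "'b list \<Rightarrow> 'b set \<Rightarrow> bool" where
  "enumerates xs B \<longleftrightarrow> distinct xs \<and> set xs = B"

text \<open>
  An input lists, in any order: the attributes, each with the elements and the order relation
  of its lattice; the tuples, each as its values in the order of the attributes; and \<open>X\<close>;
  followed by \<open>A\<close>. The comparability functions are not part of the tree, but available
  through \<^const>\<open>Cmp\<close>.
\<close>

definition encodes ::
    "('a, 'v, 'l) schema \<Rightarrow> ('a \<Rightarrow> 'v) set \<Rightarrow> 'a set \<Rightarrow> 'a \<Rightarrow> ('a, 'v, 'l) atom tree \<Rightarrow> bool" where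
  "encodes S r X A d \<longleftrightarrow>
     (\<exists>Us els ords ts Xs.
        enumerates Us (attrs S) \<and>
        (\<forall>B \<in> attrs S.
           enumerates (els B) (carrier (lat S B)) \<and>
           enumerates (ords B)
             {(x, y). x \<in> carrier (lat S B) \<and> y \<in> carrier (lat S B) \<and> x \<sqsubseteq>\<^bsub>lat S B\<^esub> y}) \<and>
        enumerates ts r \<and>
        enumerates Xs X \<and>
        d = list_tree
          [list_tree (map (\<lambda>B. list_tree
             [At (Attr B),
              list_tree (map (\<lambda>x. At (Elem x)) (els B)),
              list_tree (map (\<lambda>(x, y). Node (At (Elem x)) (At (Elem y))) (ords B))]) Us),
           list_tree (map (\<lambda>t. list_tree (map (\<lambda>B. At (Val (t B))) Us)) ts),
           list_tree (map (\<lambda>B. At (Attr B)) Xs),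
           At (Attr A)])"

end

theory Submission
  imports Defs
begin

text \<open>
  A meet-preserving attribute interpretation of a finite lattice is the indicator of a principal
  filter, so a reality is a choice of an element \<open>a\<^sub>B \<noteq> \<bottom>\<close> in each lattice. To satisfy \<open>X \<rightarrow> A\<close> it is
  best to take \<open>a\<^sub>B = \<top>\<close> for all \<open>B \<noteq> A\<close>. What remains is to find \<open>a\<^sub>A \<noteq> \<bottom>\<close> below the \<open>A\<close>-comparison of
  every pair of tuples whose comparisons are \<open>\<top>\<close> on \<open>X\<close>, provided that no lattice is trivial. This
  condition only quantifies over items listed in the input, and a formula with such quantifiers
  is evaluated by nested loops in polynomial time.
\<close>

section \<open>The criterion\<close>

lemma meet_prod_lat:
  assumes lat: "\<And>A. A \<in> attrs S \<Longrightarrow> lower_semilattice (lat S A)"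
    and x: "x \<in> carrier (prod_lat S)" and y: "y \<in> carrier (prod_lat S)"
  shows "x \<sqinter>\<^bsub>prod_lat S\<^esub> y = (\<lambda>A \<in> attrs S. x A \<sqinter>\<^bsub>lat S A\<^esub> y A)"
    (is "_ = ?m")
    and "x \<sqinter>\<^bsub>prod_lat S\<^esub> y \<in> carrier (prod_lat S)"
proof -
  let ?P = "prod_lat S"
  have le: "u \<sqsubseteq>\<^bsub>?P\<^esub> v \<longleftrightarrow> (\<forall>A \<in> attrs S. u A \<sqsubseteq>\<^bsub>lat S A\<^esub> v A)" for u v
    by (simp add: prod_lat_def)
  have carr: "u \<in> carrier ?P \<longleftrightarrow> u \<in> (\<Pi>\<^sub>E A \<in> attrs S. carrier (lat S A))" for u
    by (simp add: prod_lat_def)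
  have comp: "u A \<in> carrier (lat S A)" if "u \<in> carrier ?P" "A \<in> attrs S" for u A
    using that by (auto simp: carr)
  have semi: "weak_lower_semilattice (lat S A)" if "A \<in> attrs S" for A
  proof -
    interpret lower_semilattice "lat S A" using lat[OF that] .
    show ?thesis by unfold_locales
  qed
  have m: "?m \<in> carrier ?P"
    using comp[OF x] comp[OF y] semi
    by (auto simp: carr intro: weak_lower_semilattice.meet_closed)
  have great: "greatest ?P ?m (Lower ?P {x, y})"
  proof (rule greatest_LowerI)
    show "?m \<sqsubseteq>\<^bsub>?P\<^esub> z" if "z \<in> {x, y}" for z
      using that comp[OF x] comp[OF y] semi
      by (auto simp: le intro: weak_lower_semilattice.meet_left weak_lower_semilattice.meet_right)
    show "z \<sqsubseteq>\<^bsub>?P\<^esub> ?m" if "z \<in> Lower ?P {x, y}" for z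
    proof -
      have z: "z \<in> carrier ?P" and "z \<sqsubseteq>\<^bsub>?P\<^esub> x" "z \<sqsubseteq>\<^bsub>?P\<^esub> y"
        using that x y by (auto simp: Lower_def)
      then show ?thesis
        using comp[OF x] comp[OF y] comp[OF z] semi
        by (auto simp: le intro: weak_lower_semilattice.meet_le)
    qed
  qed (use x y m in auto)
  \<comment> \<open>\<open>\<sqinter>\<close> is a Hilbert choice among greatest lower bounds, so
    uniqueness is needed too. It follows from antisymmetry in each coordinate, as elements of the
    carrier are extensional.\<close>
  have "g = ?m" if g: "greatest ?P g (Lower ?P {x, y})" for g
  proof (rule PiE_ext)
    show "g \<in> (\<Pi>\<^sub>E A \<in> attrs S. carrier (lat S A))" "?m \<in> (\<Pi>\<^sub>E A \<in> attrs S. carrier (lat S A))"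
      using m greatest_closed[OF g] by (simp_all only: carr)
    have "g \<sqsubseteq>\<^bsub>?P\<^esub> ?m" "?m \<sqsubseteq>\<^bsub>?P\<^esub> g"
      using g great by (meson greatest_le greatest_mem)+
    then show "g A = ?m A" if "A \<in> attrs S" for A
      using lat[OF that] comp[OF greatest_closed[OF g] that] comp[OF m that] that
      unfolding le lower_semilattice_def by (meson partial_order.le_antisym)
  qed
  with great show "x \<sqinter>\<^bsub>prod_lat S\<^esub> y = ?m"
    unfolding meet_def[of "prod_lat S"] inf_def[of "prod_lat S"] by (rule some_equality)
  with m show "x \<sqinter>\<^bsub>prod_lat S\<^esub> y \<in> carrier (prod_lat S)" by simp
qed

text \<open>Adding the elements of \<open>F\<close> one at a time, \<open>down\<close> keeps the
  lower bound inside \<open>M\<close>. With \<open>F = M\<close> this gives a least element, which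
  is how a finite filter is seen to be principal.\<close>

lemma finite_lower_bound_in:
  assumes "weak_partial_order L" and "finite F" and "F \<subseteq> M" and "M \<subseteq> carrier L" and "M \<noteq> {}"
    and down: "\<And>x y. x \<in> M \<Longrightarrow> y \<in> M \<Longrightarrow> \<exists>z \<in> M. z \<sqsubseteq>\<^bsub>L\<^esub> x \<and> z \<sqsubseteq>\<^bsub>L\<^esub> y"
  shows "\<exists>e \<in> M. \<forall>y \<in> F. e \<sqsubseteq>\<^bsub>L\<^esub> y"
  using assms(2,3)
proof (induction F rule: finite_induct)
  case empty
  then show ?case using \<open>M \<noteq> {}\<close> by auto
next
  case (insert a F)
  then obtain e where e: "e \<in> M" "\<forall>y \<in> F. e \<sqsubseteq>\<^bsub>L\<^esub> y" by auto
  with insert.prems down obtain z where z: "z \<in> M" "z \<sqsubseteq>\<^bsub>L\<^esub> a" "z \<sqsubseteq>\<^bsub>L\<^esub> e" by (meson insert_subset)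
  interpret weak_partial_order L by fact
  have "z \<sqsubseteq>\<^bsub>L\<^esub> y" if "y \<in> F" for y
  proof (rule le_trans[OF z(3)])
    show "e \<sqsubseteq>\<^bsub>L\<^esub> y" using e that by blast
    show "z \<in> carrier L" "e \<in> carrier L" "y \<in> carrier L"
      using z(1) e(1) insert.prems that assms(4) by auto
  qed
  then show ?case using z by auto
qed

text \<open>
  The top elements are not marked in the input, so \<open>\<top>\<close> is expressed by the comparison of a value
  with itself.
\<close>

definition criterion :: "('a, 'v, 'l) schema \<Rightarrow> ('a \<Rightarrow> 'v) set \<Rightarrow> 'a set \<Rightarrow> 'a \<Rightarrow> bool" where
  "criterion S r X A \<longleftrightarrow>
     (\<forall>B \<in> attrs S. \<exists>x \<in> carrier (lat S B). \<exists>y \<in> carrier (lat S B). x \<noteq> y) \<and>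
     (\<exists>e \<in> carrier (lat S A). (\<exists>x \<in> carrier (lat S A). \<not> e \<sqsubseteq>\<^bsub>lat S A\<^esub> x) \<and>
        (\<forall>t1 \<in> r. \<forall>t2 \<in> r.
           (\<forall>B \<in> X. cmp S B (t1 B) (t1 B) = cmp S B (t1 B) (t2 B)) \<longrightarrow>
           e \<sqsubseteq>\<^bsub>lat S A\<^esub> cmp S A (t1 A) (t2 A)))"

section \<open>Equivalence of the criterion with the existence of a reality\<close>

context
  fixes S :: "('a, 'v, 'l) schema" and r :: "('a \<Rightarrow> 'v) set" and X :: "'a set" and A :: 'a
  assumes S: "schema_context S" and r: "relation_over S r" and dep: "func_dep S X A"
begin

lemma bounded_lattice_lat: "B \<in> attrs S \<Longrightarrow> bounded_lattice (lat S B)"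
  using S by (simp add: schema_context_def)

lemma lower_semilattice_lat: "B \<in> attrs S \<Longrightarrow> lower_semilattice (lat S B)"
  using bounded_lattice_lat by (auto simp: bounded_lattice_def lattice_def)

lemma tuple_in_vals: "t \<in> r \<Longrightarrow> B \<in> attrs S \<Longrightarrow> t B \<in> vals S B"
  using r by (auto simp: relation_over_def)

lemma cmp_in_carrier:
  "t1 \<in> r \<Longrightarrow> t2 \<in> r \<Longrightarrow> B \<in> attrs S \<Longrightarrow> cmp S B (t1 B) (t2 B) \<in> carrier (lat S B)"
proof -
  assume "t1 \<in> r" "t2 \<in> r" "B \<in> attrs S"
  then have "(t1 B, t2 B) \<in> vals S B \<times> vals S B"
    and "(\<lambda>(u, v). cmp S B u v) ` (vals S B \<times> vals S B) = carrier (lat S B)"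
    using S tuple_in_vals by (auto simp: schema_context_def)
  then show ?thesis by force
qed

lemma cmp_self: "t \<in> r \<Longrightarrow> B \<in> attrs S \<Longrightarrow> cmp S B (t B) (t B) = \<top>\<^bsub>lat S B\<^esub>"
  using S tuple_in_vals by (auto simp: schema_context_def)

lemma tuple_cmp_in_prod_lat: "t1 \<in> r \<Longrightarrow> t2 \<in> r \<Longrightarrow> tuple_cmp S t1 t2 \<in> carrier (prod_lat S)"
  using cmp_in_carrier by (auto simp: tuple_cmp_def prod_lat_def)

lemma bot_in_lat: "B \<in> attrs S \<Longrightarrow> \<bottom>\<^bsub>lat S B\<^esub> \<in> carrier (lat S B)"
proof -
  assume "B \<in> attrs S"
  then interpret bounded_lattice "lat S B" by (rule bounded_lattice_lat)
  show ?thesis by (rule bottom_closed)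
qed

lemma top_in_lat: "B \<in> attrs S \<Longrightarrow> \<top>\<^bsub>lat S B\<^esub> \<in> carrier (lat S B)"
proof -
  assume "B \<in> attrs S"
  then interpret bounded_lattice "lat S B" by (rule bounded_lattice_lat)
  show ?thesis by (rule top_closed)
qed

lemma A_in_attrs: "A \<in> attrs S" and X_subset_attrs: "X \<subseteq> attrs S" and A_notin_X: "A \<notin> X"
  using dep by (auto simp: func_dep_def)

text \<open>The least element of the filter \<open>{y. h A y}\<close> is the witness.\<close>

lemma criterion_necessary:
  assumes "reality S g" and sat: "satisfies_fd S g r X A"
  shows "criterion S r X A"
proof -
  obtain h where
    h: "\<And>B. B \<in> attrs S \<Longrightarrow> attribute_interpretation (lat S B) (h B)"
    and g: "\<And>x. x \<in> carrier (prod_lat S) \<Longrightarrow> g x = {B \<in> attrs S. h B (x B)}"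
    and hom: "\<And>x y. x \<in> carrier (prod_lat S) \<Longrightarrow> y \<in> carrier (prod_lat S) \<Longrightarrow>
                g (x \<sqinter>\<^bsub>prod_lat S\<^esub> y) = g x \<inter> g y"
    using assms(1) unfolding reality_def schema_interpretation_def by blast
  have top: "h B \<top>\<^bsub>lat S B\<^esub>" and bot: "\<not> h B \<bottom>\<^bsub>lat S B\<^esub>" if "B \<in> attrs S" for B
    using h[OF that] by (auto simp: attribute_interpretation_def)
  interpret bounded_lattice "lat S A" by (rule bounded_lattice_lat[OF A_in_attrs])
  let ?F = "{y \<in> carrier (lat S A). h A y}"
  have "\<exists>z \<in> ?F. z \<sqsubseteq>\<^bsub>lat S A\<^esub> x \<and> z \<sqsubseteq>\<^bsub>lat S A\<^esub> y" if x: "x \<in> ?F" and y: "y \<in> ?F" for x y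
  proof
    \<comment> \<open>The homomorphism law concerns \<open>g\<close> on the whole product. Padding
      with \<open>\<top>\<close> embeds the lattice of \<open>A\<close>, so that the law can be read
      off at coordinate \<open>A\<close>.\<close>
    let ?ext = "\<lambda>x. \<lambda>B \<in> attrs S. if B = A then x else \<top>\<^bsub>lat S B\<^esub>"
    have ext: "?ext x \<in> carrier (prod_lat S)" if "x \<in> ?F" for x
      using that top_in_lat by (auto simp: prod_lat_def)
    have meet: "?ext x \<sqinter>\<^bsub>prod_lat S\<^esub> ?ext y = (\<lambda>B \<in> attrs S. ?ext x B \<sqinter>\<^bsub>lat S B\<^esub> ?ext y B)"
        "?ext x \<sqinter>\<^bsub>prod_lat S\<^esub> ?ext y \<in> carrier (prod_lat S)"
      using meet_prod_lat[OF _ ext[OF x] ext[OF y]] lower_semilattice_lat by auto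
    have "A \<in> g (?ext x)" "A \<in> g (?ext y)"
      using x y g[OF ext] A_in_attrs by auto
    then have "A \<in> g (?ext x \<sqinter>\<^bsub>prod_lat S\<^esub> ?ext y)"
      using hom[OF ext[OF x] ext[OF y]] by blast
    then have "h A ((?ext x \<sqinter>\<^bsub>prod_lat S\<^esub> ?ext y) A)"
      using g[OF meet(2)] by blast
    then show "x \<sqinter>\<^bsub>lat S A\<^esub> y \<in> ?F"
      using x y A_in_attrs unfolding meet(1) by simp
    show "x \<sqinter>\<^bsub>lat S A\<^esub> y \<sqsubseteq>\<^bsub>lat S A\<^esub> x \<and> x \<sqinter>\<^bsub>lat S A\<^esub> y \<sqsubseteq>\<^bsub>lat S A\<^esub> y"
      using x y by (auto intro: meet_left meet_right)
  qed
  moreover have "finite ?F"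
    using S A_in_attrs by (auto simp: schema_context_def)
  moreover have "?F \<noteq> {}"
    using top A_in_attrs top_closed by auto
  ultimately obtain e where e: "e \<in> ?F" "\<And>y. y \<in> ?F \<Longrightarrow> e \<sqsubseteq>\<^bsub>lat S A\<^esub> y"
    using finite_lower_bound_in[OF weak_partial_order_axioms, of ?F ?F] by auto
  \<comment> \<open>\<open>h B\<close> separates \<open>\<top>\<close> from
    \<open>\<bottom>\<close>, so these two elements differ.\<close>
  have nontriv: "\<exists>x \<in> carrier (lat S B). \<exists>y \<in> carrier (lat S B). x \<noteq> y" if "B \<in> attrs S" for B
    using top[OF that] bot[OF that] top_in_lat[OF that] bot_in_lat[OF that] by metis
  have nonbot: "\<not> e \<sqsubseteq>\<^bsub>lat S A\<^esub> \<bottom>\<^bsub>lat S A\<^esub>"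
  proof
    assume "e \<sqsubseteq>\<^bsub>lat S A\<^esub> \<bottom>\<^bsub>lat S A\<^esub>"
    then have "e = \<bottom>\<^bsub>lat S A\<^esub>" using e(1) by auto
    then show False using e(1) bot[OF A_in_attrs] by simp
  qed
  have below: "e \<sqsubseteq>\<^bsub>lat S A\<^esub> cmp S A (t1 A) (t2 A)"
    if t: "t1 \<in> r" "t2 \<in> r" and eq: "\<forall>B \<in> X. cmp S B (t1 B) (t1 B) = cmp S B (t1 B) (t2 B)" for t1 t2
  proof (rule e(2))
    let ?x = "tuple_cmp S t1 t2"
    have gx: "g ?x = {B \<in> attrs S. h B (?x B)}"
      using g tuple_cmp_in_prod_lat[OF t] by blast
    \<comment> \<open>Where the two tuples compare like \<open>t1\<close> with itself, the value is
      \<open>\<top>\<close>, which every \<open>h B\<close> accepts.\<close>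
    have "h B (?x B)" if "B \<in> X" for B
    proof -
      have B: "B \<in> attrs S" using that X_subset_attrs by blast
      then have "?x B = \<top>\<^bsub>lat S B\<^esub>"
        using eq that cmp_self[OF t(1) B] by (simp add: tuple_cmp_def)
      then show ?thesis using top[OF B] by simp
    qed
    then have "X \<subseteq> g ?x"
      using X_subset_attrs gx by blast
    then have "A \<in> g ?x"
      using sat t unfolding satisfies_fd_def rel_cmp_def by blast
    then show "cmp S A (t1 A) (t2 A) \<in> ?F"
      using gx cmp_in_carrier t A_in_attrs by (auto simp: tuple_cmp_def)
  qed
  show ?thesis
    unfolding criterion_def
  proof (rule conjI)
    show "\<forall>B \<in> attrs S. \<exists>x \<in> carrier (lat S B). \<exists>y \<in> carrier (lat S B). x \<noteq> y"
      using nontriv by (rule ballI)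
    have "\<exists>x \<in> carrier (lat S A). \<not> e \<sqsubseteq>\<^bsub>lat S A\<^esub> x"
      using nonbot bottom_closed by (rule bexI)
    with below e(1) show "\<exists>e \<in> carrier (lat S A). (\<exists>x \<in> carrier (lat S A). \<not> e \<sqsubseteq>\<^bsub>lat S A\<^esub> x) \<and>
        (\<forall>t1 \<in> r. \<forall>t2 \<in> r.
           (\<forall>B \<in> X. cmp S B (t1 B) (t1 B) = cmp S B (t1 B) (t2 B)) \<longrightarrow>
           e \<sqsubseteq>\<^bsub>lat S A\<^esub> cmp S A (t1 A) (t2 A))"
      by - (rule bexI[of _ e], intro conjI ballI impI, simp_all)
  qed
qed

text \<open>
  Taking \<open>h B = (\<lambda>z. z = \<top>)\<close> for \<open>B \<noteq> A\<close> makes the premise \<open>X \<subseteq> g x\<close> as strong as possible.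
\<close>

lemma criterion_sufficient:
  assumes "criterion S r X A"
  shows "\<exists>g. reality S g \<and> satisfies_fd S g r X A"
proof -
  obtain e x0 where nontriv: "\<And>B. B \<in> attrs S \<Longrightarrow> \<exists>x \<in> carrier (lat S B). \<exists>y \<in> carrier (lat S B). x \<noteq> y"
    and e: "e \<in> carrier (lat S A)" "x0 \<in> carrier (lat S A)" "\<not> e \<sqsubseteq>\<^bsub>lat S A\<^esub> x0"
    and fd: "\<And>t1 t2. t1 \<in> r \<Longrightarrow> t2 \<in> r \<Longrightarrow>
           \<forall>B \<in> X. cmp S B (t1 B) (t1 B) = cmp S B (t1 B) (t2 B) \<Longrightarrow>
           e \<sqsubseteq>\<^bsub>lat S A\<^esub> cmp S A (t1 A) (t2 A)"
    using assms unfolding criterion_def by blast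
  \<comment> \<open>\<open>a B\<close> generates the principal filter accepted by
    \<open>h B\<close>. For \<open>B \<noteq> A\<close> that filter consists of
    \<open>\<top>\<close> alone.\<close>
  define a where "a B = (if B = A then e else \<top>\<^bsub>lat S B\<^esub>)" for B
  define h where "h B z \<longleftrightarrow> a B \<sqsubseteq>\<^bsub>lat S B\<^esub> z" for B z
  define g where "g x = {B \<in> attrs S. h B (x B)}" for x
  have a: "a B \<in> carrier (lat S B)" if "B \<in> attrs S" for B
    using that e(1) top_in_lat by (simp add: a_def)
  have "attribute_interpretation (lat S B) (h B)" if B: "B \<in> attrs S" for B
  proof -
    interpret bounded_lattice "lat S B" by (rule bounded_lattice_lat[OF B])
    \<comment> \<open>A generator below \<open>\<bottom>\<close> would be below everything. At
      \<open>A\<close> this contradicts \<open>x0\<close>; elsewhere every element would be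
      \<open>\<top>\<close>, against \<open>nontriv\<close>.\<close>
    have "\<not> a B \<sqsubseteq>\<^bsub>lat S B\<^esub> \<bottom>\<^bsub>lat S B\<^esub>"
    proof
      assume low: "a B \<sqsubseteq>\<^bsub>lat S B\<^esub> \<bottom>\<^bsub>lat S B\<^esub>"
      have below: "a B \<sqsubseteq>\<^bsub>lat S B\<^esub> z" if "z \<in> carrier (lat S B)" for z
        using le_trans[OF low] that a[OF B] bottom_lower bottom_closed by blast
      show False
      proof (cases "B = A")
        case True
        then show False using below e by (auto simp: a_def)
      next
        case False
        then have "z = \<top>\<^bsub>lat S B\<^esub>" if "z \<in> carrier (lat S B)" for z
          using below that by (auto simp: a_def)
        then show False using nontriv[OF B] by metis
      qed
    qed
    then show ?thesis
      using a[OF B] by (auto simp: attribute_interpretation_def h_def intro: le_trans)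
  qed
  moreover have "g (x \<sqinter>\<^bsub>prod_lat S\<^esub> y) = g x \<inter> g y"
    if x: "x \<in> carrier (prod_lat S)" and y: "y \<in> carrier (prod_lat S)" for x y
  proof -
    \<comment> \<open>This is the universal property of the meet: \<open>a B\<close> is below a meet
      iff it is below both arguments.\<close>
    have "h B (x B \<sqinter>\<^bsub>lat S B\<^esub> y B) \<longleftrightarrow> h B (x B) \<and> h B (y B)" if B: "B \<in> attrs S" for B
    proof -
      interpret bounded_lattice "lat S B" by (rule bounded_lattice_lat[OF B])
      have "x B \<in> carrier (lat S B)" "y B \<in> carrier (lat S B)"
        using x y B by (auto simp: prod_lat_def)
      then show ?thesis
        unfolding h_def using a[OF B] by (meson le_trans meet_closed meet_le meet_left meet_right)
    qed
    then show ?thesis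
      using meet_prod_lat(1)[OF lower_semilattice_lat x y] by (auto simp: g_def)
  qed
  ultimately have "reality S g"
    unfolding reality_def schema_interpretation_def by (auto simp: g_def intro!: exI[of _ h])
  moreover have "A \<in> g (tuple_cmp S t1 t2)"
    if t: "t1 \<in> r" "t2 \<in> r" and X: "X \<subseteq> g (tuple_cmp S t1 t2)" for t1 t2
  proof -
    have "cmp S B (t1 B) (t1 B) = cmp S B (t1 B) (t2 B)" if BX: "B \<in> X" for B
    proof -
      have B: "B \<in> attrs S" and "B \<noteq> A" using BX X_subset_attrs A_notin_X by auto
      then have le: "\<top>\<^bsub>lat S B\<^esub> \<sqsubseteq>\<^bsub>lat S B\<^esub> cmp S B (t1 B) (t2 B)"
        using X BX by (auto simp: g_def h_def a_def tuple_cmp_def)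
      interpret bounded_lattice "lat S B" by (rule bounded_lattice_lat[OF B])
      show ?thesis
        using le cmp_in_carrier[OF t B] cmp_self[OF t(1) B] by auto
    qed
    then show ?thesis
      using fd[OF t] A_in_attrs by (simp add: g_def h_def a_def tuple_cmp_def)
  qed
  then have "satisfies_fd S g r X A"
    unfolding satisfies_fd_def rel_cmp_def by blast
  ultimately show ?thesis by blast
qed

lemma pfd_iff_criterion: "(\<exists>g. reality S g \<and> satisfies_fd S g r X A) \<longleftrightarrow> criterion S r X A"
  using criterion_necessary criterion_sufficient by blast

end

section \<open>Compiling bounded quantification\<close>

definition runs :: "('a \<Rightarrow> 'v \<Rightarrow> 'v \<Rightarrow> 'l) \<Rightarrow> com \<Rightarrow> ('a, 'v, 'l) atom state \<Rightarrow> nat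
    \<Rightarrow> (('a, 'v, 'l) atom state \<Rightarrow> bool) \<Rightarrow> bool" where
  "runs f c s T Q \<longleftrightarrow> (\<exists>t s'. exec f c s t s' \<and> t \<le> T \<and> Q s')"

lemma runs_mono: "runs f c s T Q \<Longrightarrow> T \<le> T' \<Longrightarrow> (\<And>s'. Q s' \<Longrightarrow> Q' s') \<Longrightarrow> runs f c s T' Q'"
  unfolding runs_def by (meson le_trans)

lemma runs_Skip: "Q s \<Longrightarrow> 1 \<le> T \<Longrightarrow> runs f Skip s T Q"
  unfolding runs_def by (blast intro: exec.Skip)

lemma runs_Assign: "Q (s(n := eval f e s)) \<Longrightarrow> 1 + ecost e \<le> T \<Longrightarrow> runs f (Assign n e) s T Q"
  unfolding runs_def by (blast intro: exec.Assign)

lemma runs_Seq: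
  assumes "runs f c1 s T1 Q1" and "\<And>s'. Q1 s' \<Longrightarrow> runs f c2 s' T2 Q" and "1 + T1 + T2 \<le> T"
  shows "runs f (Seq c1 c2) s T Q"
proof -
  obtain t1 s1 where 1: "exec f c1 s t1 s1" "t1 \<le> T1" "Q1 s1"
    using assms(1) unfolding runs_def by blast
  obtain t2 s2 where 2: "exec f c2 s1 t2 s2" "t2 \<le> T2" "Q s2"
    using assms(2)[OF 1(3)] unfolding runs_def by blast
  have "exec f (Seq c1 c2) s (1 + t1 + t2) s2" using 1(1) 2(1) by (rule exec.Seq)
  moreover have "1 + t1 + t2 \<le> T" using 1(2) 2(2) assms(3) by simp
  ultimately show ?thesis unfolding runs_def using 2(3) by blast
qed

lemma runs_Assign_Seq:
  "runs f c (s(n := eval f e s)) T' Q \<Longrightarrow> 2 + ecost e + T' \<le> T \<Longrightarrow> runs f (Seq (Assign n e) c) s T Q"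
  by (rule runs_Seq[where ?Q1.0 = "\<lambda>s'. s' = s(n := eval f e s)" and ?T1.0 = "1 + ecost e" and ?T2.0 = T'])
    (auto intro: runs_Assign)

lemma runs_If:
  assumes "eval f b s \<noteq> Leaf \<Longrightarrow> runs f c1 s T' Q" and "eval f b s = Leaf \<Longrightarrow> runs f c2 s T' Q"
    and "1 + ecost b + T' \<le> T"
  shows "runs f (If b c1 c2) s T Q"
proof (cases "eval f b s = Leaf")
  case True
  then obtain t s' where "exec f c2 s t s'" "t \<le> T'" "Q s'"
    using assms(2) unfolding runs_def by blast
  then show ?thesis
    using True assms(3) exec.IfFalse[of f b s c2 t s' c1] unfolding runs_def
    by (intro exI[of _ "1 + ecost b + t"] exI[of _ s']) auto
next
  case False
  then obtain t s' where "exec f c1 s t s'" "t \<le> T'" "Q s'"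
    using assms(1) unfolding runs_def by blast
  then show ?thesis
    using False assms(3) exec.IfTrue[of f b s c1 t s' c2] unfolding runs_def
    by (intro exI[of _ "1 + ecost b + t"] exI[of _ s']) auto
qed

lemma runs_While_stop:
  "eval f b s = Leaf \<Longrightarrow> Q s \<Longrightarrow> 1 + ecost b \<le> T \<Longrightarrow> runs f (While b c) s T Q"
  unfolding runs_def by (blast intro: exec.WhileFalse)

lemma runs_While_step:
  assumes "eval f b s \<noteq> Leaf" and "runs f c s T1 Q1"
    and "\<And>s'. Q1 s' \<Longrightarrow> runs f (While b c) s' T2 Q" and "1 + ecost b + T1 + T2 \<le> T"
  shows "runs f (While b c) s T Q"
proof -
  obtain t1 s1 where 1: "exec f c s t1 s1" "t1 \<le> T1" "Q1 s1"
    using assms(2) unfolding runs_def by blast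
  obtain t2 s2 where 2: "exec f (While b c) s1 t2 s2" "t2 \<le> T2" "Q s2"
    using assms(3)[OF 1(3)] unfolding runs_def by blast
  have "exec f (While b c) s (1 + ecost b + t1 + t2) s2"
    using assms(1) 1(1) 2(1) by (rule exec.WhileTrue)
  moreover have "1 + ecost b + t1 + t2 \<le> T" using 1(2) 2(2) assms(4) by simp
  ultimately show ?thesis unfolding runs_def using 2(3) by blast
qed

text \<open>
  Walking three lists in parallel, as long as the first one lasts, gives access to the values of
  two tuples at the same attribute. A single list is walked with \<^const>\<open>Leaf\<close> as the other two.
\<close>

fun rows :: "'c tree \<Rightarrow> 'c tree \<Rightarrow> 'c tree \<Rightarrow> 'c tree list" where
  "rows Leaf y z = []"
| "rows (At c) y z = [Node Leaf (Node (hd_tree y) (hd_tree z))]"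
| "rows (Node a x) y z = Node a (Node (hd_tree y) (hd_tree z)) # rows x (tl_tree y) (tl_tree z)"

text \<open>An atom has head and tail \<open>Leaf\<close>, so it fits the equation for pairs. Hence
  the rows match the iterations of a loop guarded by the first list, even for a tree that is no
  proper list.\<close>

lemma rows_unfold:
  "x \<noteq> Leaf \<Longrightarrow> rows x y z =
     Node (hd_tree x) (Node (hd_tree y) (hd_tree z)) # rows (tl_tree x) (tl_tree y) (tl_tree z)"
  by (cases x) auto

text \<open>A quantifier over a single list binds its variable to such a row, so formulas reach the
  item itself through \<open>Hd\<close>.\<close>

lemma set_rows_list_tree:
  "set (rows (list_tree xs) Leaf Leaf) = (\<lambda>x. Node x (Node Leaf Leaf)) ` set xs"
  by (induction xs) auto

text \<open>Tuples are encoded in the order of the attributes, so all three lists are maps of one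
  list and each row joins items that belong together.\<close>

lemma set_rows_map:
  "set (rows (list_tree (map a xs)) (list_tree (map b xs)) (list_tree (map c xs)))
     = (\<lambda>x. Node (a x) (Node (b x) (c x))) ` set xs"
  by (induction xs) auto

lemma true_ne_Leaf [simp]: "true \<noteq> Leaf"
  by (simp add: true_def)

lemma eq_tree_Leaf_iff [simp]: "eq_tree x Leaf = Leaf \<longleftrightarrow> x \<noteq> Leaf"
  by (cases x) auto

lemma nodes_pos: "1 \<le> nodes x"
  by (cases x) auto

lemma nodes_hd_tree: "nodes (hd_tree x) \<le> nodes x"
  by (cases x) auto

lemma nodes_tl_tree: "nodes (tl_tree x) \<le> nodes x"
  by (cases x) auto

lemma length_rows: "length (rows x y z) \<le> nodes x"
  by (induction x y z rule: rows.induct) auto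

text \<open>The 2 counts the two pairs built around the three heads. This controls the size of a
  bound variable, as \<open>length_rows\<close> controls the number of iterations.\<close>

lemma nodes_rows: "w \<in> set (rows x y z) \<Longrightarrow> nodes w \<le> 2 + nodes x + nodes y + nodes z"
proof (induction x y z rule: rows.induct)
  case (2 c y z)
  then show ?case using nodes_hd_tree[of y] nodes_hd_tree[of z] by auto
next
  case (3 a x y z)
  then show ?case
    using nodes_hd_tree[of y] nodes_hd_tree[of z] nodes_tl_tree[of y] nodes_tl_tree[of z] by auto
qed auto

section \<open>Formulas with quantifiers bounded by lists\<close>

datatype form =
    Test expr
  | Neg form
  | Conj form form
  | ExRow nat expr expr expr form

fun sat :: "('a \<Rightarrow> 'v \<Rightarrow> 'v \<Rightarrow> 'l) \<Rightarrow> form \<Rightarrow> ('a, 'v, 'l) atom state \<Rightarrow> bool" where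
  "sat f (Test e) s \<longleftrightarrow> eval f e s \<noteq> Leaf"
| "sat f (Neg \<phi>) s \<longleftrightarrow> \<not> sat f \<phi> s"
| "sat f (Conj \<phi> \<psi>) s \<longleftrightarrow> sat f \<phi> s \<and> sat f \<psi> s"
| "sat f (ExRow v e1 e2 e3 \<phi>) s \<longleftrightarrow>
     (\<exists>x \<in> set (rows (eval f e1 s) (eval f e2 s) (eval f e3 s)). sat f \<phi> (s(v := x)))"

fun vars_below :: "nat \<Rightarrow> expr \<Rightarrow> bool" where
  "vars_below k (V n) \<longleftrightarrow> n < k"
| "vars_below k Null \<longleftrightarrow> True"
| "vars_below k (Cons e1 e2) \<longleftrightarrow> vars_below k e1 \<and> vars_below k e2"
| "vars_below k (Hd e) \<longleftrightarrow> vars_below k e"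
| "vars_below k (Tl e) \<longleftrightarrow> vars_below k e"
| "vars_below k (Eq e1 e2) \<longleftrightarrow> vars_below k e1 \<and> vars_below k e2"
| "vars_below k (Cmp e1 e2 e3) \<longleftrightarrow> vars_below k e1 \<and> vars_below k e2 \<and> vars_below k e3"

fun form_below :: "nat \<Rightarrow> form \<Rightarrow> bool" where
  "form_below k (Test e) \<longleftrightarrow> vars_below k e"
| "form_below k (Neg \<phi>) \<longleftrightarrow> form_below k \<phi>"
| "form_below k (Conj \<phi> \<psi>) \<longleftrightarrow> form_below k \<phi> \<and> form_below k \<psi>"
| "form_below k (ExRow v e1 e2 e3 \<phi>) \<longleftrightarrow>
     v < k \<and> vars_below k e1 \<and> vars_below k e2 \<and> vars_below k e3 \<and> form_below k \<phi>"

lemma eval_cong: "vars_below k e \<Longrightarrow> (\<And>n. n < k \<Longrightarrow> s n = s' n) \<Longrightarrow> eval f e s = eval f e s'"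
  by (induction e) auto

text \<open>Compiled programs overwrite scratch variables; the truth of a formula must not depend on
  what they leave there.\<close>

lemma sat_cong: "form_below k \<phi> \<Longrightarrow> (\<And>n. n < k \<Longrightarrow> s n = s' n) \<Longrightarrow> sat f \<phi> s \<longleftrightarrow> sat f \<phi> s'"
proof (induction \<phi> arbitrary: s s')
  case (Test e)
  then show ?case using eval_cong[of k e s s' f] by simp
next
  case (Neg \<phi>)
  then show ?case by (metis form_below.simps(2) sat.simps(2))
next
  case (Conj \<phi> \<psi>)
  then show ?case by (metis form_below.simps(3) sat.simps(3))
next
  case (ExRow v e1 e2 e3 \<phi>)
  have "eval f e s = eval f e s'" if "vars_below k e" for e
    using that ExRow.prems(2) by (rule eval_cong)
  moreover have "sat f \<phi> (s(v := x)) \<longleftrightarrow> sat f \<phi> (s'(v := x))" for x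
    using ExRow.prems by (intro ExRow.IH) auto
  ultimately show ?case using ExRow.prems(1) by simp
qed

text \<open>Only \<open>Cons\<close> combines sizes, and there the costs add up as well. The results
  of tests and comparisons have constant size.\<close>

lemma nodes_eval:
  assumes "1 \<le> N" and "\<And>n. n < k \<Longrightarrow> nodes (s n) \<le> N"
  shows "vars_below k e \<Longrightarrow> nodes (eval f e s) \<le> ecost e * N"
proof (induction e)
  case (V n)
  then show ?case using assms by simp
next
  case Null
  then show ?case using assms by simp
next
  case (Cons e1 e2)
  then show ?case using assms(1) by (simp add: algebra_simps)
next
  case (Hd e)
  then show ?case using nodes_hd_tree[of "eval f e s"] by simp
next
  case (Tl e)
  then show ?case using nodes_tl_tree[of "eval f e s"] by simp
next
  case (Eq e1 e2)
  \<comment> \<open>\<open>true\<close> has three nodes, paid for by the three summands of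
    \<open>ecost (Eq e1 e2) * N\<close>, each at least 1.\<close>
  have "nodes (eval f (Eq e1 e2) s) \<le> 3"
    by (cases "(eval f e1 s, eval f e2 s)" rule: eq_tree.cases) (auto simp: true_def)
  moreover have "1 * 1 \<le> ecost e * N" for e
    by (rule mult_le_mono) (use assms(1) in \<open>cases e; auto\<close>)+
  from this[of e1] this[of e2] have "3 \<le> N + ecost e1 * N + ecost e2 * N"
    using assms(1) by linarith
  ultimately show ?case by (simp add: algebra_simps)
next
  case (Cmp e1 e2 e3)
  have "nodes (eval f (Cmp e1 e2 e3) s) = 1"
    by (cases "(f, eval f e1 s, eval f e2 s, eval f e3 s)" rule: cmp_tree.cases) auto
  then show ?case using assms(1) by simp
qed

text \<open>
  \<open>compile k \<phi>\<close> leaves its result in variable \<open>k\<close> and uses the variables from \<open>k\<close> on as scratch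
  space: \<open>k\<close>, \<open>k + 1\<close>, \<open>k + 2\<close> hold the lists still to be walked, \<open>k + 3\<close> the result so far, and
  \<open>k + 4\<close> the value of the bound variable to be restored.
\<close>

definition ex_body :: "nat \<Rightarrow> nat \<Rightarrow> com \<Rightarrow> com" where
  "ex_body k v c =
     Seq (Assign v (Cons (Hd (V k)) (Cons (Hd (V (k + 1))) (Hd (V (k + 2))))))
    (Seq (Assign k (Tl (V k)))
    (Seq (Assign (k + 1) (Tl (V (k + 1))))
    (Seq (Assign (k + 2) (Tl (V (k + 2))))
    (Seq c
         (If (V (k + 5)) (Assign (k + 3) (V (k + 5))) Skip)))))"

fun compile :: "nat \<Rightarrow> form \<Rightarrow> com" where
  "compile k (Test e) = Assign k e"
| "compile k (Neg \<phi>) = Seq (compile k \<phi>) (Assign k (Eq (V k) Null))"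
| "compile k (Conj \<phi> \<psi>) = Seq (compile k \<phi>) (If (V k) (compile k \<psi>) Skip)"
| "compile k (ExRow v e1 e2 e3 \<phi>) =
     Seq (Assign k e1)
    (Seq (Assign (k + 1) e2)
    (Seq (Assign (k + 2) e3)
    (Seq (Assign (k + 3) Null)
    (Seq (Assign (k + 4) (V v))
    (Seq (While (V k) (ex_body k v (compile (k + 5) \<phi>)))
    (Seq (Assign v (V (k + 4)))
         (Assign k (V (k + 3)))))))))"

text \<open>The argument of the polynomial bounds the sizes of the variables. A quantifier makes at
  most \<open>ecost e1 * N\<close> iterations, each with overhead 29: 27 in the body and 2 for the
  guard. The composition accounts for the body running with a row, of size linear in
  \<open>N\<close>, in the bound variable.\<close>

fun cost :: "form \<Rightarrow> nat poly" where
  "cost (Test e) = [:1 + ecost e:]"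
| "cost (Neg \<phi>) = cost \<phi> + [:5:]"
| "cost (Conj \<phi> \<psi>) = cost \<phi> + cost \<psi> + [:4:]"
| "cost (ExRow v e1 e2 e3 \<phi>) =
     [:20 + ecost e1 + ecost e2 + ecost e3:] +
     [:0, ecost e1:] * ([:29:] + pcompose (cost \<phi>) [:0, 2 + ecost e1 + ecost e2 + ecost e3:])"

text \<open>The flag in \<open>k + 3\<close> accumulates a disjunction: it may be set but is never
  cleared. The assumption \<open>c\<close> leaves the scratch variables arbitrary, since earlier
  iterations may have changed them.\<close>

lemma runs_ex_body:
  assumes "v < k" and "s k \<noteq> Leaf"
    and x: "x = Node (hd_tree (s k)) (Node (hd_tree (s (k + 1))) (hd_tree (s (k + 2))))"
    and c: "\<And>s'. s' v = x \<Longrightarrow> (\<And>n. n < k \<Longrightarrow> n \<noteq> v \<Longrightarrow> s' n = s n) \<Longrightarrow>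
          runs f c s' T (\<lambda>s''. (\<forall>n < k + 5. s'' n = s' n) \<and> (s'' (k + 5) \<noteq> Leaf \<longleftrightarrow> P))"
  shows "runs f (ex_body k v c) s (27 + T)
          (\<lambda>s'. (\<forall>n < k. n \<noteq> v \<longrightarrow> s' n = s n) \<and> s' k = tl_tree (s k) \<and>
             s' (k + 1) = tl_tree (s (k + 1)) \<and> s' (k + 2) = tl_tree (s (k + 2)) \<and>
             (s' (k + 3) \<noteq> Leaf \<longleftrightarrow> s (k + 3) \<noteq> Leaf \<or> P) \<and> s' (k + 4) = s (k + 4))"
  unfolding ex_body_def
  apply (rule runs_Assign_Seq[where T' = "17 + T"])
   apply (rule runs_Assign_Seq[where T' = "13 + T"])
    apply (rule runs_Assign_Seq[where T' = "9 + T"])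
     apply (rule runs_Assign_Seq[where T' = "5 + T"])
      apply (rule runs_Seq[where ?T1.0 = T and ?T2.0 = 4])
        apply (rule c)
  using assms(1)
         apply (simp_all add: x)
  apply (rule runs_If[where T' = 2])
  using assms(1) by (auto intro!: runs_Assign runs_Skip)

text \<open>Induction on the rows still to be walked. The assumption on \<open>c\<close> refers to
  \<open>s\<close> only below \<open>k\<close> and away from \<open>v\<close>, where an iteration
  changes nothing, so it carries over to the next state.\<close>

lemma runs_ex_loop:
  assumes "v < k"
    and c: "\<And>s' x. x \<in> set R \<Longrightarrow> s' v = x \<Longrightarrow> (\<And>n. n < k \<Longrightarrow> n \<noteq> v \<Longrightarrow> s' n = s n) \<Longrightarrow>
          runs f c s' T (\<lambda>s''. (\<forall>n < k + 5. s'' n = s' n) \<and> (s'' (k + 5) \<noteq> Leaf \<longleftrightarrow> P x))"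
    and "rows (s k) (s (k + 1)) (s (k + 2)) = R"
  shows "runs f (While (V k) (ex_body k v c)) s (2 + length R * (29 + T))
          (\<lambda>s'. (\<forall>n < k. n \<noteq> v \<longrightarrow> s' n = s n) \<and>
             (s' (k + 3) \<noteq> Leaf \<longleftrightarrow> s (k + 3) \<noteq> Leaf \<or> (\<exists>x \<in> set R. P x)) \<and> s' (k + 4) = s (k + 4))"
  using assms(2,3)
proof (induction R arbitrary: s)
  case Nil
  then have "s k = Leaf" by (cases "s k") auto
  then show ?case by (auto intro!: runs_While_stop)
next
  case (Cons x R)
  then have ne: "s k \<noteq> Leaf" by auto
  from Cons.prems(2) have x: "x = Node (hd_tree (s k)) (Node (hd_tree (s (k + 1))) (hd_tree (s (k + 2))))"
    and R: "R = rows (tl_tree (s k)) (tl_tree (s (k + 1))) (tl_tree (s (k + 2)))"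
    using rows_unfold[OF ne] by auto
  show ?case
  proof (rule runs_While_step)
    show "runs f (ex_body k v c) s (27 + T)
          (\<lambda>s'. (\<forall>n < k. n \<noteq> v \<longrightarrow> s' n = s n) \<and> s' k = tl_tree (s k) \<and>
             s' (k + 1) = tl_tree (s (k + 1)) \<and> s' (k + 2) = tl_tree (s (k + 2)) \<and>
             (s' (k + 3) \<noteq> Leaf \<longleftrightarrow> s (k + 3) \<noteq> Leaf \<or> P x) \<and> s' (k + 4) = s (k + 4))"
      by (rule runs_ex_body[OF assms(1) ne x], rule Cons.prems(1)) auto
  next
    fix s'
    assume s': "(\<forall>n < k. n \<noteq> v \<longrightarrow> s' n = s n) \<and> s' k = tl_tree (s k) \<and>
             s' (k + 1) = tl_tree (s (k + 1)) \<and> s' (k + 2) = tl_tree (s (k + 2)) \<and>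
             (s' (k + 3) \<noteq> Leaf \<longleftrightarrow> s (k + 3) \<noteq> Leaf \<or> P x) \<and> s' (k + 4) = s (k + 4)"
    have "runs f (While (V k) (ex_body k v c)) s' (2 + length R * (29 + T))
          (\<lambda>s''. (\<forall>n < k. n \<noteq> v \<longrightarrow> s'' n = s' n) \<and>
             (s'' (k + 3) \<noteq> Leaf \<longleftrightarrow> s' (k + 3) \<noteq> Leaf \<or> (\<exists>x \<in> set R. P x)) \<and> s'' (k + 4) = s' (k + 4))"
    proof (rule Cons.IH)
      show "rows (s' k) (s' (k + 1)) (s' (k + 2)) = R" using s' R by simp
      show "runs f c u T (\<lambda>u'. (\<forall>n < k + 5. u' n = u n) \<and> (u' (k + 5) \<noteq> Leaf \<longleftrightarrow> P y))"
        if "y \<in> set R" "u v = y" "\<And>n. n < k \<Longrightarrow> n \<noteq> v \<Longrightarrow> u n = s' n" for u y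
        using that s' by (intro Cons.prems(1)) auto
    qed
    then show "runs f (While (V k) (ex_body k v c)) s' (2 + length R * (29 + T))
          (\<lambda>s'. (\<forall>n < k. n \<noteq> v \<longrightarrow> s' n = s n) \<and>
             (s' (k + 3) \<noteq> Leaf \<longleftrightarrow> s (k + 3) \<noteq> Leaf \<or> (\<exists>x \<in> set (x # R). P x)) \<and>
             s' (k + 4) = s (k + 4))"
      by (rule runs_mono) (use s' in auto)
  qed (use ne in auto)
qed

text \<open>\<open>m\<close> bounds the variables of the formula and stays fixed, while
  \<open>k\<close> moves up by 5 at each nested quantifier, keeping the scratch areas apart.
  \<open>N\<close> must vary in the induction, because a bound variable can hold a row larger than
  \<open>N\<close>.\<close>

lemma runs_compile:
  assumes "form_below m \<phi>" and "m \<le> k" and "1 \<le> N" and "\<And>n. n < m \<Longrightarrow> nodes (s n) \<le> N"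
  shows "runs f (compile k \<phi>) s (poly (cost \<phi>) N)
          (\<lambda>s'. (\<forall>n < k. s' n = s n) \<and> (s' k \<noteq> Leaf \<longleftrightarrow> sat f \<phi> s))"
  using assms
proof (induction \<phi> arbitrary: k s N)
  case (Test e)
  then show ?case by (auto intro!: runs_Assign)
next
  case (Neg \<phi>)
  show ?case
    using Neg.prems by (auto intro!: runs_Seq[OF Neg.IH[of k N s]] runs_Assign)
next
  case (Conj \<phi> \<psi>)
  show ?case
    unfolding compile.simps
  proof (rule runs_Seq[OF Conj.IH(1)[of k N s]])
    fix s1
    assume s1: "(\<forall>n < k. s1 n = s n) \<and> (s1 k \<noteq> Leaf \<longleftrightarrow> sat f \<phi> s)"
    have eq: "sat f \<psi> s1 \<longleftrightarrow> sat f \<psi> s"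
      using Conj.prems s1 by (intro sat_cong[of m]) auto
    have "runs f (compile k \<psi>) s1 (poly (cost \<psi>) N)
            (\<lambda>s'. (\<forall>n < k. s' n = s1 n) \<and> (s' k \<noteq> Leaf \<longleftrightarrow> sat f \<psi> s1))"
      using Conj.prems s1 by (intro Conj.IH(2)) auto
    then show "runs f (If (V k) (compile k \<psi>) Skip) s1 (poly (cost \<psi>) N + 3)
          (\<lambda>s'. (\<forall>n < k. s' n = s n) \<and> (s' k \<noteq> Leaf \<longleftrightarrow> sat f (Conj \<phi> \<psi>) s))"
      using s1 eq
      by (intro runs_If[where T' = "poly (cost \<psi>) N + 1"]) (auto intro!: runs_Skip elim!: runs_mono)
  qed (use Conj.prems in auto)
next
  case (ExRow v e1 e2 e3 \<phi>)
  define E where "E = ecost e1 + ecost e2 + ecost e3"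
  \<comment> \<open>Size bound inside the loop: \<open>E\<close> for the three lists and 2 for the
    pairs that form a row.\<close>
  define M where "M = (2 + E) * N"
  define s1 where "s1 = s(k := eval f e1 s, k + 1 := eval f e2 s, k + 2 := eval f e3 s,
    k + 3 := Leaf, k + 4 := s v)"
  define R where "R = rows (eval f e1 s) (eval f e2 s) (eval f e3 s)"
  \<comment> \<open>\<open>e2\<close> and \<open>e3\<close> are evaluated after \<open>k\<close> and
    \<open>k + 1\<close> have been overwritten; their variables lie below \<open>m\<close>, so this
    does no harm.\<close>
  have ev: "eval f e (s(k := x)) = eval f e s" "eval f e (s(k := x, Suc k := y)) = eval f e s"
    if "vars_below m e" for e x y
    using that ExRow.prems(2) by (auto intro!: eval_cong[of m])
  have nodes_ev: "nodes (eval f e s) \<le> ecost e * N" if "vars_below m e" for e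
    using ExRow.prems that by (intro nodes_eval) auto
  have "N \<le> M" by (simp add: M_def)
  have lenR: "length R \<le> ecost e1 * N"
    using length_rows nodes_ev[of e1] ExRow.prems(1) unfolding R_def by (meson form_below.simps(4) le_trans)
  have small: "nodes x \<le> M" if "x \<in> set R" for x
  proof -
    have "nodes x \<le> 2 + nodes (eval f e1 s) + nodes (eval f e2 s) + nodes (eval f e3 s)"
      using that unfolding R_def by (rule nodes_rows)
    also have "\<dots> \<le> 2 * N + ecost e1 * N + ecost e2 * N + ecost e3 * N"
      using nodes_ev[of e1] nodes_ev[of e2] nodes_ev[of e3] ExRow.prems(1,3) by simp
    also have "\<dots> = M" by (simp add: M_def E_def algebra_simps)
    finally show ?thesis .
  qed
  define T where "T = poly (cost \<phi>) M"
  have loop: "runs f (While (V k) (ex_body k v (compile (k + 5) \<phi>))) s1 (2 + length R * (29 + T))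
          (\<lambda>s'. (\<forall>n < k. n \<noteq> v \<longrightarrow> s' n = s1 n) \<and>
             (s' (k + 3) \<noteq> Leaf \<longleftrightarrow> s1 (k + 3) \<noteq> Leaf \<or> (\<exists>x \<in> set R. sat f \<phi> (s(v := x)))) \<and>
             s' (k + 4) = s1 (k + 4))"
  proof (rule runs_ex_loop)
    show "v < k" using ExRow.prems by simp
    show "rows (s1 k) (s1 (k + 1)) (s1 (k + 2)) = R" by (simp add: s1_def R_def)
    fix s' x
    assume x: "x \<in> set R" "s' v = x" and s': "\<And>n. n < k \<Longrightarrow> n \<noteq> v \<Longrightarrow> s' n = s1 n"
    have agree: "s' n = (s(v := x)) n" if "n < m" for n
      using that x(2) s'[of n] ExRow.prems(2) by (auto simp: s1_def)
    have "sat f \<phi> s' \<longleftrightarrow> sat f \<phi> (s(v := x))"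
      using ExRow.prems(1) agree by (intro sat_cong[of m]) auto
    moreover have "nodes (s' n) \<le> M" if "n < m" for n
      using agree[OF that] small[OF x(1)] ExRow.prems(4)[OF that] \<open>N \<le> M\<close> by auto
    then have "runs f (compile (k + 5) \<phi>) s' (poly (cost \<phi>) M)
          (\<lambda>s''. (\<forall>n < k + 5. s'' n = s' n) \<and> (s'' (k + 5) \<noteq> Leaf \<longleftrightarrow> sat f \<phi> s'))"
      using ExRow.prems \<open>N \<le> M\<close> by (intro ExRow.IH) auto
    ultimately show "runs f (compile (k + 5) \<phi>) s' T
          (\<lambda>s''. (\<forall>n < k + 5. s'' n = s' n) \<and> (s'' (k + 5) \<noteq> Leaf \<longleftrightarrow> sat f \<phi> (s(v := x))))"
      by (simp add: T_def)
  qed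
  have "runs f (Seq (While (V k) (ex_body k v (compile (k + 5) \<phi>)))
              (Seq (Assign v (V (k + 4))) (Assign k (V (k + 3))))) s1 (8 + length R * (29 + T))
          (\<lambda>s'. (\<forall>n < k. s' n = s n) \<and> (s' k \<noteq> Leaf \<longleftrightarrow> sat f (ExRow v e1 e2 e3 \<phi>) s))"
    using ExRow.prems(1,2)
    by (intro runs_Seq[OF loop, where ?T2.0 = 5] runs_Assign_Seq[where T' = 2])
      (auto simp: s1_def R_def intro!: runs_Assign)
  then have "runs f (compile k (ExRow v e1 e2 e3 \<phi>)) s (20 + E + length R * (29 + T))
          (\<lambda>s'. (\<forall>n < k. s' n = s n) \<and> (s' k \<noteq> Leaf \<longleftrightarrow> sat f (ExRow v e1 e2 e3 \<phi>) s))"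
    using ExRow.prems(1,2) unfolding compile.simps
    by (intro runs_Assign_Seq[where T' = "18 + ecost e2 + ecost e3 + length R * (29 + T)"]
        runs_Assign_Seq[where T' = "16 + ecost e3 + length R * (29 + T)"]
        runs_Assign_Seq[where T' = "14 + length R * (29 + T)"]
        runs_Assign_Seq[where T' = "11 + length R * (29 + T)"]
        runs_Assign_Seq[where T' = "8 + length R * (29 + T)"])
      (simp_all add: s1_def ev E_def)
  then show ?case
  proof (rule runs_mono)
    show "20 + E + length R * (29 + T) \<le> poly (cost (ExRow v e1 e2 e3 \<phi>)) N"
      using mult_le_mono1[OF lenR, of "29 + T"]
      by (simp add: E_def T_def M_def poly_pcompose algebra_simps)
  qed
qed

text \<open>Initially only variable 0 can differ from \<open>Leaf\<close>, so \<open>nodes d\<close>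
  bounds all variables. The 3 pays for sequencing and for copying the result to variable 0.\<close>

lemma decides_within_form:
  assumes "form_below k \<phi>" and "0 < k"
  shows "decides_within f (Seq (compile k \<phi>) (Assign 0 (V k))) d (poly (cost \<phi> + [:3:]) (nodes d))
          (sat f \<phi> (init_state d))"
proof -
  have "runs f (Seq (compile k \<phi>) (Assign 0 (V k))) (init_state d) (poly (cost \<phi> + [:3:]) (nodes d))
          (\<lambda>s'. s' 0 \<noteq> Leaf \<longleftrightarrow> sat f \<phi> (init_state d))"
  proof (rule runs_Seq[OF runs_compile[OF assms(1) order.refl, of "nodes d"]])
    show "1 \<le> nodes d" by (rule nodes_pos)
    then show "nodes (init_state d n) \<le> nodes d" for n by (simp add: init_state_def)
  qed (auto intro!: runs_Assign)
  then show ?thesis by (auto simp: runs_def decides_within_def)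
qed

section \<open>The criterion as a formula\<close>

definition AllRow :: "nat \<Rightarrow> expr \<Rightarrow> expr \<Rightarrow> expr \<Rightarrow> form \<Rightarrow> form" where
  "AllRow v e1 e2 e3 \<phi> = Neg (ExRow v e1 e2 e3 (Neg \<phi>))"

definition Imp :: "form \<Rightarrow> form \<Rightarrow> form" where
  "Imp \<phi> \<psi> = Neg (Conj \<phi> (Neg \<psi>))"

lemma sat_AllRow [simp]:
  "sat f (AllRow v e1 e2 e3 \<phi>) s \<longleftrightarrow>
     (\<forall>x \<in> set (rows (eval f e1 s) (eval f e2 s) (eval f e3 s)). sat f \<phi> (s(v := x)))"
  by (simp add: AllRow_def)

lemma sat_Imp [simp]: "sat f (Imp \<phi> \<psi>) s \<longleftrightarrow> (sat f \<phi> s \<longrightarrow> sat f \<psi> s)"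
  by (simp add: Imp_def)

lemma form_below_AllRow_Imp [simp]:
  "form_below k (AllRow v e1 e2 e3 \<phi>) \<longleftrightarrow> form_below k (ExRow v e1 e2 e3 \<phi>)"
  "form_below k (Imp \<phi> \<psi>) \<longleftrightarrow> form_below k \<phi> \<and> form_below k \<psi>"
  by (simp_all add: AllRow_def Imp_def)

text \<open>
  Variable 0 holds the input. Variable 1 ranges over the attribute entries, 2 over the candidates
  for the least element of the filter, 3 and 4 over tuples (3 first over the lattice), 5 over
  attribute entries with the two values at that attribute, 6 over \<open>X\<close>, and 7 over the order
  relation of the lattice in variable 1.
\<close>

definition leq_form :: "expr \<Rightarrow> expr \<Rightarrow> form" where
  "leq_form a b = ExRow 7 (Hd (Tl (Tl (Hd (V 1))))) Null Null
     (Conj (Test (Eq (Hd (Hd (V 7))) a)) (Test (Eq (Tl (Hd (V 7))) b)))"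

text \<open>Values at an attribute are reached by walking the attribute entries alongside both
  tuples. So \<open>X\<close> is handled by walking all columns, with membership in
  \<open>lhs\<close> as a guard, and the second such walk merely looks up column \<open>A\<close>.
  Nontriviality of a lattice is tested as the presence of a second listed element.\<close>

definition criterion_form :: form where
  "criterion_form =
     (let atts = Hd (V 0); tups = Hd (Tl (V 0)); lhs = Hd (Tl (Tl (V 0))); rhs = Hd (Tl (Tl (Tl (V 0))));
          att = Hd (Hd (V 5)); val1 = Hd (Tl (V 5)); val2 = Tl (Tl (V 5))
      in
      Conj
        (AllRow 1 atts Null Null (Test (Tl (Hd (Tl (Hd (V 1)))))))
        (ExRow 1 atts Null Null (Conj
          (Test (Eq (Hd (Hd (V 1))) rhs))
          (ExRow 2 (Hd (Tl (Hd (V 1)))) Null Null (Conj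
            (ExRow 3 (Hd (Tl (Hd (V 1)))) Null Null (Neg (leq_form (Hd (V 2)) (Hd (V 3)))))
            (AllRow 3 tups Null Null (AllRow 4 tups Null Null (Imp
              (AllRow 5 atts (Hd (V 3)) (Hd (V 4)) (Imp
                (ExRow 6 lhs Null Null (Test (Eq (Hd (V 6)) att)))
                (Test (Eq (Cmp att val1 val1) (Cmp att val1 val2)))))
              (AllRow 5 atts (Hd (V 3)) (Hd (V 4)) (Imp
                (Test (Eq att rhs))
                (leq_form (Hd (V 2)) (Cmp att val1 val2))))))))))))"

lemma form_below_criterion_form: "form_below 8 criterion_form"
  by (simp add: criterion_form_def leq_form_def Let_def)

lemma eq_tree_At_eq_Leaf [simp]: "eq_tree (At c) (At d) = Leaf \<longleftrightarrow> c \<noteq> d"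
  by simp

text \<open>In a list without repetitions, having two different elements means having length at
  least 2.\<close>

lemma tl_list_tree_ne_Leaf:
  assumes "distinct xs"
  shows "tl_tree (list_tree (map h xs)) \<noteq> Leaf \<longleftrightarrow> (\<exists>x \<in> set xs. \<exists>y \<in> set xs. x \<noteq> y)"
proof (cases xs)
  case (Cons a ys)
  then show ?thesis using assms by (cases ys) auto
qed simp

lemma sat_criterion_form:
  assumes dep: "func_dep S X A" and r: "relation_over S r" and S: "schema_context S"
    and enc: "encodes S r X A d"
  shows "sat (cmp S) criterion_form (init_state d) \<longleftrightarrow> criterion S r X A"
proof -
  from enc obtain Us els ords ts Xs where
    Us: "set Us = attrs S" and
    els: "\<And>B. B \<in> attrs S \<Longrightarrow> distinct (els B) \<and> set (els B) = carrier (lat S B)" and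
    ords: "\<And>B. B \<in> attrs S \<Longrightarrow> set (ords B) =
             {(x, y). x \<in> carrier (lat S B) \<and> y \<in> carrier (lat S B) \<and> x \<sqsubseteq>\<^bsub>lat S B\<^esub> y}" and
    ts: "set ts = r" and Xs: "set Xs = X" and
    d: "d = list_tree
          [list_tree (map (\<lambda>B. list_tree
             [At (Attr B),
              list_tree (map (\<lambda>x. At (Elem x)) (els B)),
              list_tree (map (\<lambda>(x, y). Node (At (Elem x)) (At (Elem y))) (ords B))]) Us),
           list_tree (map (\<lambda>t. list_tree (map (\<lambda>B. At (Val (t B))) Us)) ts),
           list_tree (map (\<lambda>B. At (Attr B)) Xs),
           At (Attr A)]"
    unfolding encodes_def enumerates_def by blast
  have A: "A \<in> attrs S" and X: "X \<subseteq> attrs S" using dep by (auto simp: func_dep_def)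
  have X_iff: "(\<forall>B \<in> attrs S. B \<in> X \<longrightarrow> P B) \<longleftrightarrow> (\<forall>B \<in> X. P B)" for P
    using X by blast
  \<comment> \<open>A negated \<open>leq_form\<close> speaks of all pairs in the order relation;
    this one-point rule reduces it to the pair in question.\<close>
  have not_below_iff: "(\<forall>b. P b \<and> Q b \<longrightarrow> b \<noteq> c) \<longleftrightarrow> (P c \<longrightarrow> \<not> Q c)" for P Q and c :: 'l
    by blast
  \<comment> \<open>The listed order relation has only pairs from the carrier, so looking up a
    comparison value in it requires this membership.\<close>
  have carr: "cmp S A (t1 A) (t2 A) \<in> carrier (lat S A)" if "t1 \<in> r" "t2 \<in> r" for t1 t2
    using cmp_in_carrier[OF S r dep that A] .
  show ?thesis
    unfolding criterion_form_def leq_form_def Let_def criterion_def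
    \<comment> \<open>The congruence rules supply the membership of bound elements, on which
      \<open>els\<close>, \<open>ords\<close> and \<open>carr\<close> depend.\<close>
    by (simp add: init_state_def d set_rows_list_tree set_rows_map Us ts Xs els ords
        tl_list_tree_ne_Leaf A X_iff carr not_below_iff split_beta del: eq_tree.simps cong: conj_cong ball_cong bex_cong)
qed

theorem theorem5:
  shows "\<exists>(c :: com) (p :: nat poly).
    \<forall>(S :: ('a, 'v, 'l) schema) r X A d.
      schema_context S \<longrightarrow> relation_over S r \<longrightarrow> func_dep S X A \<longrightarrow> encodes S r X A d \<longrightarrow>
      decides_within (cmp S) c d (poly p (nodes d))
        (\<exists>g. reality S g \<and> satisfies_fd S g r X A)"
proof (intro exI allI impI)
  fix S :: "('a, 'v, 'l) schema" and r X A d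
  assume *: "schema_context S" "relation_over S r" "func_dep S X A" "encodes S r X A d"
  \<comment> \<open>The formula uses variables 0 to 7, so scratch space starts at 8. Program and
    polynomial come from \<open>criterion_form\<close> alone, hence they are uniform in schema and
    input.\<close>
  have "decides_within (cmp S) (Seq (compile 8 criterion_form) (Assign 0 (V 8))) d
          (poly (cost criterion_form + [:3:]) (nodes d)) (sat (cmp S) criterion_form (init_state d))"
    by (rule decides_within_form[OF form_below_criterion_form]) simp
  then show "decides_within (cmp S) (Seq (compile 8 criterion_form) (Assign 0 (V 8))) d
          (poly (cost criterion_form + [:3:]) (nodes d)) (\<exists>g. reality S g \<and> satisfies_fd S g r X A)"
    using sat_criterion_form[of S X A r d] pfd_iff_criterion[of S r X A] * by simp
qed

end
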